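(* Let $n$ be a positive integer and let $\boldsymbol{\alpha}=(\alpha_1,\dots,\alpha_n)$ be an $n$-tuple of pairwise incommensurable real numbers. Then $$\mathfrak{k}(\boldsymbol{\alpha})\ \ge\ \sqrt{\frac{n}{2}}.$$
   Context: For a real number $\alpha$ and real $t\ge 1$ put $\psi_\alpha(t)=\min_{q\in\mathbb{Z}_+,\ q\le t}\|q\alpha\|$, where $\mathbb{Z}_+$ is the set of positive integers and $\|x\|=\min_{a\in\mathbb{Z}}|x-a|$ (the irrationality measure function of $\alpha$). Two real numbers $\alpha,\beta$ are called incommensurable if $\psi_\alpha(t)\ne\psi_\beta(t)$ for all sufficiently large $t$. Let $\boldsymbol{\alpha}=(\alpha_1,\dots,\alpha_n)$ be an $n$-tuple of pairwise incommensurable real numbers (i.e. $\alpha_i,\alpha_j$ are incommensurable for all $i\ne j$). For every sufficiently large $t$ the values $\psi_{\alpha_1}(t),\dots,\psi_{\alpha_n}(t)$ are pairwise distinct, so there is a unique permutation $\boldsymbol{\sigma}(t):\{1,2,\dots,n\}\mapsto\{\sigma_1,\sigma_2,\dots,\sigma_n\}$ with $$\psi_{\alpha_{\sigma_1}}(t)>\psi_{\alpha_{\sigma_2}}(t)>\dots>\psi_{\alpha_{\sigma_n}}(t).$$ The $\mathfrak{k}$-index of $\boldsymbol{\alpha}$ is $$\mathfrak{k}(\boldsymbol{\alpha})=\max\{k:\ \text{there exist distinct permutations } \boldsymbol{\sigma}_1,\dots,\boldsymbol{\sigma}_k \text{ such that } \forall j\ \forall t_0>0\ \exists t>t_0 \text{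 with } \boldsymbol{\sigma}(t)=\boldsymbol{\sigma}_j\},$$ i.e. the number of permutations that occur as $\boldsymbol{\sigma}(t)$ for arbitrarily large $t$. *)

theory Defs
  imports "HOL-Analysis.Analysis" "HOL-Combinatorics.Permutations"
begin

definition dist_int :: "real \<Rightarrow> real" where
  "dist_int x = (INF a::int. \<bar>x - of_int a\<bar>)"

text \<open>The infimum is a minimum.\<close>

lemma dist_int_eq_round: "dist_int x = \<bar>x - of_int (round x)\<bar>"
  unfolding dist_int_def
  by (rule cInf_eq_minimum) (auto intro: round_diff_minimal)

text \<open>Only meaningful for \<open>t \<ge> 1\<close>, where the set under the minimum is finite and nonempty.\<close>

definition irr_measure :: "real \<Rightarrow> real \<Rightarrow> real" where
  "irr_measure \<alpha> t = Min ((\<lambda>q::nat. dist_int (real q * \<alpha>)) ` {q. 0 < q \<and> real q \<le> t})"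

definition incommensurable :: "real \<Rightarrow> real \<Rightarrow> bool" where
  "incommensurable \<alpha> \<beta> \<longleftrightarrow> (\<forall>\<^sub>F t in at_top. irr_measure \<alpha> t \<noteq> irr_measure \<beta> t)"

text \<open>
  An \<open>n\<close>-tuple is a function \<open>\<alpha> :: nat \<Rightarrow> real\<close> of which only the values on \<open>{1..n}\<close> matter.
\<close>

definition pairwise_incommensurable :: "nat \<Rightarrow> (nat \<Rightarrow> real) \<Rightarrow> bool" where
  "pairwise_incommensurable n \<alpha> \<longleftrightarrow>
     (\<forall>i\<in>{1..n}. \<forall>j\<in>{1..n}. i \<noteq> j \<longrightarrow> incommensurable (\<alpha> i) (\<alpha> j))"

definition is_order_perm :: "nat \<Rightarrow> (nat \<Rightarrow> real) \<Rightarrow> real \<Rightarrow> (nat \<Rightarrow> nat) \<Rightarrow> bool" where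
  "is_order_perm n \<alpha> t \<sigma> \<longleftrightarrow> \<sigma> permutes {1..n} \<and>
     (\<forall>i\<in>{1..n}. \<forall>j\<in>{1..n}. i < j \<longrightarrow> irr_measure (\<alpha> (\<sigma> i)) t > irr_measure (\<alpha> (\<sigma> j)) t)"

definition order_perm :: "nat \<Rightarrow> (nat \<Rightarrow> real) \<Rightarrow> real \<Rightarrow> (nat \<Rightarrow> nat)" where
  "order_perm n \<alpha> t = (THE \<sigma>. is_order_perm n \<alpha> t \<sigma>)"

definition k_index_set :: "nat \<Rightarrow> (nat \<Rightarrow> real) \<Rightarrow> nat set" where
  "k_index_set n \<alpha> =
     {k. \<exists>s :: nat \<Rightarrow> (nat \<Rightarrow> nat). inj_on s {1..k} \<and>
           (\<forall>j\<in>{1..k}. s j permutes {1..n} \<and>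
              (\<forall>t0>0. \<exists>t>t0. order_perm n \<alpha> t = s j))}"

definition k_index :: "nat \<Rightarrow> (nat \<Rightarrow> real) \<Rightarrow> nat" where
  "k_index n \<alpha> = Max (k_index_set n \<alpha>)"

text \<open>The descriptions and the maximum above are well defined.\<close>

lemma ex1_decreasing_perm:
  fixes f :: "nat \<Rightarrow> real"
  assumes inj: "inj_on f {1..n}"
  shows "\<exists>!\<sigma>. \<sigma> permutes {1..n} \<and> (\<forall>i\<in>{1..n}. \<forall>j\<in>{1..n}. i < j \<longrightarrow> f (\<sigma> i) > f (\<sigma> j))"
proof (rule ex_ex1I)
  define xs where "xs = sort_key (\<lambda>i. - f i) [1..<Suc n]"
  have len: "length xs = n" and set: "set xs = {1..n}" and dist: "distinct xs"
    by (auto simp: xs_def)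
  have sorted: "sorted (map (\<lambda>i. - f i) xs)"
    unfolding xs_def by (rule sorted_sort_key)
  define \<sigma> where "\<sigma> i = (if i \<in> {1..n} then xs ! (i - 1) else i)" for i
  have mem: "\<sigma> i \<in> {1..n}" if "i \<in> {1..n}" for i
  proof -
    have "xs ! (i - 1) \<in> set xs" using that len by (intro nth_mem) auto
    then show ?thesis using that set by (simp add: \<sigma>_def)
  qed
  have inj\<sigma>: "inj_on \<sigma> {1..n}"
    by (rule inj_onI) (use dist len in \<open>auto simp: \<sigma>_def nth_eq_iff_index_eq\<close>)
  have "\<sigma> permutes {1..n}"
  proof (rule bij_imp_permutes)
    have "\<sigma> ` {1..n} = {1..n}"
      by (rule endo_inj_surj) (use mem inj\<sigma> in auto)
    with inj\<sigma> show "bij_betw \<sigma> {1..n} {1..n}" by (simp add: bij_betw_def)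
  qed (auto simp: \<sigma>_def)
  moreover have "f (\<sigma> i) > f (\<sigma> j)" if ij: "i \<in> {1..n}" "j \<in> {1..n}" "i < j" for i j
  proof -
    have "map (\<lambda>i. - f i) xs ! (i - 1) \<le> map (\<lambda>i. - f i) xs ! (j - 1)"
      by (rule sorted_nth_mono[OF sorted]) (use ij len in auto)
    then have "f (\<sigma> i) \<ge> f (\<sigma> j)" using ij len by (simp add: \<sigma>_def)
    moreover have "\<sigma> i \<noteq> \<sigma> j" using inj\<sigma> ij by (auto dest: inj_onD)
    then have "f (\<sigma> i) \<noteq> f (\<sigma> j)" using inj mem ij by (meson inj_onD)
    ultimately show ?thesis by linarith
  qed
  ultimately show "\<exists>\<sigma>. \<sigma> permutes {1..n} \<and>
      (\<forall>i\<in>{1..n}. \<forall>j\<in>{1..n}. i < j \<longrightarrow> f (\<sigma> i) > f (\<sigma> j))" by blast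
next
  fix \<sigma> \<tau>
  assume \<sigma>: "\<sigma> permutes {1..n} \<and> (\<forall>i\<in>{1..n}. \<forall>j\<in>{1..n}. i < j \<longrightarrow> f (\<sigma> i) > f (\<sigma> j))"
    and \<tau>: "\<tau> permutes {1..n} \<and> (\<forall>i\<in>{1..n}. \<forall>j\<in>{1..n}. i < j \<longrightarrow> f (\<tau> i) > f (\<tau> j))"
  have strict: "sorted_wrt (<) (map (\<lambda>i. - f (\<rho> i)) [1..<Suc n])"
    and img: "set (map (\<lambda>i. - f (\<rho> i)) [1..<Suc n]) = (\<lambda>i. - f i) ` {1..n}"
    if "\<rho> permutes {1..n} \<and> (\<forall>i\<in>{1..n}. \<forall>j\<in>{1..n}. i < j \<longrightarrow> f (\<rho> i) > f (\<rho> j))" for \<rho>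
  proof -
    show "sorted_wrt (<) (map (\<lambda>i. - f (\<rho> i)) [1..<Suc n])"
      using that by (auto simp: sorted_wrt_iff_nth_less simp del: upt_Suc)
    have "set (map (\<lambda>i. - f (\<rho> i)) [1..<Suc n]) = (\<lambda>i. - f i) ` (\<rho> ` {1..n})"
      by (auto simp: image_image atLeastLessThanSuc_atLeastAtMost simp del: upt_Suc)
    then show "set (map (\<lambda>i. - f (\<rho> i)) [1..<Suc n]) = (\<lambda>i. - f i) ` {1..n}"
      using that by (simp add: permutes_image del: upt_Suc)
  qed
  have eq: "map (\<lambda>i. - f (\<sigma> i)) [1..<Suc n] = map (\<lambda>i. - f (\<tau> i)) [1..<Suc n]"
    by (rule strict_sorted_equal) (use strict[OF \<sigma>] strict[OF \<tau>] img[OF \<sigma>] img[OF \<tau>] in auto)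
  have "f (\<sigma> i) = f (\<tau> i)" if "i \<in> {1..n}" for i
    using eq that by (auto simp: map_eq_conv simp del: upt_Suc)
  then have "\<sigma> i = \<tau> i" if "i \<in> {1..n}" for i
    using that inj \<sigma> \<tau> by (meson inj_onD permutes_in_image)
  then show "\<sigma> = \<tau>"
    using \<sigma> \<tau> by (metis ext permutes_not_in)
qed

lemma eventually_is_order_perm:
  assumes "pairwise_incommensurable n \<alpha>"
  shows "\<forall>\<^sub>F t in at_top. is_order_perm n \<alpha> t (order_perm n \<alpha> t)"
proof -
  have "\<forall>\<^sub>F t in at_top. \<forall>i\<in>{1..n}. \<forall>j\<in>{1..n}. i \<noteq> j \<longrightarrow>
          irr_measure (\<alpha> i) t \<noteq> irr_measure (\<alpha> j) t"
    using assms
    by (auto simp: pairwise_incommensurable_def incommensurable_def intro!: eventually_ball_finite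
        elim!: eventually_mono)
  then show ?thesis
  proof eventually_elim
    case (elim t)
    then have "inj_on (\<lambda>i. irr_measure (\<alpha> i) t) {1..n}" by (auto simp: inj_on_def)
    from ex1_decreasing_perm[OF this] have "\<exists>!\<sigma>. is_order_perm n \<alpha> t \<sigma>"
      by (simp add: is_order_perm_def)
    then show ?case unfolding order_perm_def by (rule theI')
  qed
qed

lemma zero_in_k_index_set: "0 \<in> k_index_set n \<alpha>"
  by (simp add: k_index_set_def)

lemma finite_k_index_set: "finite (k_index_set n \<alpha>)"
proof (rule finite_subset)
  show "k_index_set n \<alpha> \<subseteq> {..card {p. p permutes {1..n}}}"
  proof
    fix k assume "k \<in> k_index_set n \<alpha>"
    then obtain s :: "nat \<Rightarrow> nat \<Rightarrow> nat" where
      "inj_on s {1..k}" "s ` {1..k} \<subseteq> {p. p permutes {1..n}}"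
      by (auto simp: k_index_set_def)
    then have "card {1..k} \<le> card {p. p permutes {1..n}}"
      by (intro card_inj_on_le[of s]) (auto intro: finite_permutations)
    then show "k \<in> {..card {p. p permutes {1..n}}}" by simp
  qed
qed simp

end

theory Submission
  imports Defs
begin

text \<open>
  Let \<open>q < q'\<close> be consecutive denominators of best approximations to \<open>\<alpha>\<close>. If the measure function
  of \<open>\<beta>\<close> lies below that of \<open>\<alpha>\<close> at \<open>q\<close>, then it jumps at most once in \<open>(q, q']\<close>, and if it does,
  then at \<open>q'\<close> it lies above that of \<open>\<alpha>\<close>; both follow from \<open>q' \<xi> + q \<xi>' = 1\<close>. Hence any two
  irrational members of the tuple overtake each other infinitely often. Moreover two incommensurable
  irrationals share only finitely many pairs of consecutive denominators.

  Start at a late time \<open>T\<close> and let each of several indices be paired with one below it. The orderings at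
  the distinct times of first overtaking within the pairs, together with the one at \<open>T\<close>, are
  pairwise distinct, so there are at most \<open>k - 1\<close> such times. If all indices considered jump at \<open>T\<close>,
  and each is paired with the one below it that jumps next, then at most two overtakings
  coincide; so at most \<open>2 k - 1\<close> functions jump simultaneously. Pairing every index with the lowest one
  at \<open>T\<close> then gives at most \<open>1 + (2 k - 1) (k - 1)\<close> irrational members. At most one member is rational.
\<close>

section \<open>Best approximations\<close>

lemma dist_int_le: "dist_int x \<le> \<bar>x - of_int a\<bar>"
  using round_diff_minimal[of x a] by (simp add: dist_int_eq_round)

lemma dist_int_nonneg: "0 \<le> dist_int x"
  by (simp add: dist_int_eq_round)

lemma dist_int_le_half: "dist_int x \<le> 1 / 2"
  using of_int_round_abs_le[of x] by (simp add: dist_int_eq_round abs_minus_commute)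

lemma dist_int_eq_0_iff: "dist_int x = 0 \<longleftrightarrow> x \<in> \<int>"
  unfolding dist_int_eq_round by (auto simp: Ints_def)

lemma dist_int_mult_pos:
  assumes "\<alpha> \<notin> \<rat>" "0 < (q::nat)"
  shows "0 < dist_int (real q * \<alpha>)"
proof -
  have "real q * \<alpha> \<notin> \<int>"
  proof
    assume "real q * \<alpha> \<in> \<int>"
    then have "real q * \<alpha> / real q \<in> \<rat>"
      by (intro Rats_divide) (auto elim: Ints_cases)
    with assms show False by simp
  qed
  then show ?thesis using dist_int_nonneg[of "real q * \<alpha>"] dist_int_eq_0_iff by fastforce
qed

section \<open>The measure function at natural arguments, and its jumps\<close>

lemma irr_measure_nat:
  "irr_measure \<alpha> (real N) = Min ((\<lambda>q. dist_int (real q * \<alpha>)) ` {1..N})"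
proof -
  have "{q::nat. 0 < q \<and> real q \<le> real N} = {1..N}" by auto
  then show ?thesis by (simp add: irr_measure_def)
qed

lemma irr_measure_Suc:
  assumes "1 \<le> N"
  shows "irr_measure \<alpha> (real (Suc N)) = min (dist_int (real (Suc N) * \<alpha>)) (irr_measure \<alpha> (real N))"
  unfolding irr_measure_nat using assms
  by (subst atLeastAtMostSuc_conv) (auto simp del: of_nat_Suc)

lemma irr_measure_le:
  assumes "1 \<le> q" "q \<le> N"
  shows "irr_measure \<alpha> (real N) \<le> dist_int (real q * \<alpha>)"
  unfolding irr_measure_nat using assms by (intro Min_le) auto

lemma irr_measure_attained:
  assumes "1 \<le> N"
  obtains q where "1 \<le> q" "q \<le> N" "irr_measure \<alpha> (real N) = dist_int (real q * \<alpha>)"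
proof -
  have "irr_measure \<alpha> (real N) \<in> (\<lambda>q. dist_int (real q * \<alpha>)) ` {1..N}"
    unfolding irr_measure_nat using assms by (intro Min_in) auto
  then show ?thesis using that by auto
qed

lemma irr_measure_antimono:
  assumes "1 \<le> N" "N \<le> M"
  shows "irr_measure \<alpha> (real M) \<le> irr_measure \<alpha> (real N)"
  by (metis assms irr_measure_attained irr_measure_le le_trans)

text \<open>Denominators of best approximations of the second kind: apart from 1, exactly the
  natural numbers at which the measure function drops.\<close>

definition best :: "real \<Rightarrow> nat \<Rightarrow> bool" where
  "best \<alpha> q \<longleftrightarrow> 0 < q \<and> (\<forall>m. 0 < m \<and> m < q \<longrightarrow> dist_int (real q * \<alpha>) < dist_int (real m * \<alpha>))"

definition consecutive :: "real \<Rightarrow> nat \<Rightarrow> nat \<Rightarrow> bool" where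
  "consecutive \<alpha> q q' \<longleftrightarrow> best \<alpha> q \<and> best \<alpha> q' \<and> q < q' \<and> (\<forall>m. q < m \<and> m < q' \<longrightarrow> \<not> best \<alpha> m)"

text \<open>Applied with \<open>r\<close> the last best denominator up to \<open>q\<close> and
  \<open>s\<close> the first one after it.\<close>

lemma consecutiveI:
  assumes "best \<alpha> r" "best \<alpha> s" "r \<le> q" "q < s"
    and "\<And>m. r < m \<Longrightarrow> m \<le> q \<Longrightarrow> \<not> best \<alpha> m" "\<And>m. q < m \<Longrightarrow> m < s \<Longrightarrow> \<not> best \<alpha> m"
  shows "consecutive \<alpha> r s"
proof -
  have "\<not> best \<alpha> m" if "r < m" "m < s" for m
    using that assms(5,6)[of m] by (cases "m \<le> q") auto
  then show ?thesis using assms by (simp add: consecutive_def)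
qed

lemma best_1: "best \<alpha> 1"
  by (auto simp: best_def)

lemma irr_measure_best:
  assumes "best \<alpha> q"
  shows "irr_measure \<alpha> (real q) = dist_int (real q * \<alpha>)"
proof -
  have q: "1 \<le> q" using assms by (simp add: best_def)
  then obtain m where m: "1 \<le> m" "m \<le> q" "irr_measure \<alpha> (real q) = dist_int (real m * \<alpha>)"
    using irr_measure_attained by blast
  then have "m = q"
    using assms irr_measure_le[OF q order_refl, of \<alpha>] unfolding best_def
    by (metis le_neq_implies_less less_le_trans not_less zero_less_one)
  with m show ?thesis by simp
qed

text \<open>A multiplier that is not best is matched by a smaller one, so including it does not
  lower the minimum.\<close>

lemma irr_measure_eqI:
  assumes "1 \<le> N" "N \<le> M" "\<And>m. N < m \<Longrightarrow> m \<le> M \<Longrightarrow> \<not> best \<alpha> m"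
  shows "irr_measure \<alpha> (real M) = irr_measure \<alpha> (real N)"
  using assms(2,3)
proof (induction M rule: dec_induct)
  case (step M)
  have "\<not> best \<alpha> (Suc M)" using step by auto
  then obtain m where "0 < m" "m < Suc M" "dist_int (real m * \<alpha>) \<le> dist_int (real (Suc M) * \<alpha>)"
    by (auto simp: best_def not_less simp del: of_nat_Suc)
  then have "irr_measure \<alpha> (real M) \<le> dist_int (real (Suc M) * \<alpha>)"
    using irr_measure_le[of m M \<alpha>] by linarith
  then have "irr_measure \<alpha> (real (Suc M)) = irr_measure \<alpha> (real M)"
    using step.hyps assms(1) by (subst irr_measure_Suc) auto
  then show ?case using step by simp
qed simp

lemma exists_last_best:
  assumes "1 \<le> N"
  obtains q where "best \<alpha> q" "q \<le> N" "\<And>m. q < m \<Longrightarrow> m \<le> N \<Longrightarrow> \<not> best \<alpha> m"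
    "irr_measure \<alpha> (real N) = irr_measure \<alpha> (real q)"
proof -
  define q where "q = (GREATEST q. best \<alpha> q \<and> q \<le> N)"
  have q: "best \<alpha> q \<and> q \<le> N"
    unfolding q_def by (rule GreatestI_nat[where b = N and k = 1]) (use assms best_1 in auto)
  have max: "\<not> best \<alpha> m" if "q < m" "m \<le> N" for m
    using that Greatest_le_nat[of "\<lambda>q. best \<alpha> q \<and> q \<le> N" m N] unfolding q_def by fastforce
  have "irr_measure \<alpha> (real N) = irr_measure \<alpha> (real q)"
    by (rule irr_measure_eqI) (use q max in \<open>auto simp: best_def\<close>)
  with q max that show ?thesis by blast
qed

text \<open>Pigeonhole on the \<open>N\<close> intervals of length \<open>1/N\<close>: either two of the multiples \<open>0, \<dots>, (N - 1) \<alpha>\<close>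
  share an interval modulo 1, or one of them lies in the last interval, close to 1.\<close>

lemma dirichlet_strict_denominator:
  assumes "2 \<le> N"
  obtains q where "0 < q" "q < N" "dist_int (real q * \<alpha>) \<le> 1 / real N"
proof -
  define h where "h k = nat \<lfloor>real N * frac (real k * \<alpha>)\<rfloor>" for k :: nat
  have N: "real N > 0" using assms by simp
  have hb: "real (h k) \<le> real N * frac (real k * \<alpha>) \<and> real N * frac (real k * \<alpha>) < real (h k) + 1" for k
  proof -
    have "0 \<le> real N * frac (real k * \<alpha>)" by simp
    then have "real (h k) = of_int \<lfloor>real N * frac (real k * \<alpha>)\<rfloor>"
      unfolding h_def by (simp add: of_nat_nat)
    then show ?thesis by linarith
  qed
  have hlt: "h k < N" for k
  proof -
    have "real N * frac (real k * \<alpha>) < real N" using N frac_lt_1[of "real k * \<alpha>"] by simp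
    with hb[of k] show ?thesis by linarith
  qed
  show ?thesis
  proof (cases "inj_on h {..<N}")
    case True
    then have "h ` {..<N} = {..<N}"
      by (intro endo_inj_surj) (use hlt in auto)
    moreover have "N - 1 \<in> {..<N}" using assms by auto
    ultimately obtain k where k: "k < N" "h k = N - 1" by (metis imageE lessThan_iff)
    have "k \<noteq> 0"
    proof
      assume "k = 0"
      then have "h k = 0" by (simp add: h_def)
      with k assms show False by simp
    qed
    moreover have "dist_int (real k * \<alpha>) \<le> 1 / real N"
    proof -
      have "real N * frac (real k * \<alpha>) \<ge> real N - 1" using hb[of k] k by (simp add: of_nat_diff)
      then have "1 - frac (real k * \<alpha>) \<le> 1 / real N" using N by (simp add: field_simps)
      moreover have "\<bar>real k * \<alpha> - of_int (\<lfloor>real k * \<alpha>\<rfloor> + 1)\<bar> = 1 - frac (real k * \<alpha>)"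
        using frac_lt_1[of "real k * \<alpha>"] by (simp add: frac_def)
      ultimately show ?thesis using dist_int_le[of "real k * \<alpha>" "\<lfloor>real k * \<alpha>\<rfloor> + 1"] by linarith
    qed
    ultimately show ?thesis using that k by blast
  next
    case False
    then obtain a b where ab: "a < b" "b < N" "h a = h b"
      unfolding inj_on_def by (metis lessThan_iff linorder_neqE_nat)
    have "\<bar>real N * (frac (real b * \<alpha>) - frac (real a * \<alpha>))\<bar> \<le> 1"
      using hb[of a] hb[of b] ab by (simp add: algebra_simps abs_le_iff)
    then have "\<bar>frac (real b * \<alpha>) - frac (real a * \<alpha>)\<bar> \<le> 1 / real N"
      using N by (simp add: abs_mult pos_le_divide_eq mult.commute)
    moreover have "real (b - a) * \<alpha> - of_int (\<lfloor>real b * \<alpha>\<rfloor> - \<lfloor>real a * \<alpha>\<rfloor>)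
        = frac (real b * \<alpha>) - frac (real a * \<alpha>)"
      using ab by (simp add: frac_def of_nat_diff algebra_simps)
    ultimately have "dist_int (real (b - a) * \<alpha>) \<le> 1 / real N"
      using dist_int_le[of "real (b - a) * \<alpha>" "\<lfloor>real b * \<alpha>\<rfloor> - \<lfloor>real a * \<alpha>\<rfloor>"] by simp
    then show ?thesis using that[of "b - a"] ab by auto
  qed
qed

lemma irr_measure_pos:
  assumes "\<alpha> \<notin> \<rat>" "1 \<le> N"
  shows "0 < irr_measure \<alpha> (real N)"
proof -
  obtain q where "1 \<le> q" "irr_measure \<alpha> (real N) = dist_int (real q * \<alpha>)"
    using irr_measure_attained[OF assms(2)] by blast
  then show ?thesis using dist_int_mult_pos[OF assms(1), of q] by simp
qed

text \<open>Without best denominators beyond \<open>N\<close> the measure function would stay at a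
  positive constant, against the Dirichlet bound.\<close>

lemma exists_best_gt:
  assumes "\<alpha> \<notin> \<rat>"
  shows "\<exists>q>N. best \<alpha> q"
proof (rule ccontr)
  assume *: "\<not> (\<exists>q>N. best \<alpha> q)"
  define K where "K = max N 1"
  define c where "c = irr_measure \<alpha> (real K)"
  have c: "c > 0" unfolding c_def K_def by (rule irr_measure_pos[OF assms]) simp
  obtain M :: nat where M: "1 / c < real M" using reals_Archimedean2 by blast
  \<comment> \<open>\<open>L\<close> is at least 2 for Dirichlet, at least \<open>K\<close> so that
    the value there is still \<open>c\<close>, and at least \<open>M\<close> so that
    \<open>1 / L < c\<close>.\<close>
  define L where "L = max 2 (max K M)"
  have "irr_measure \<alpha> (real L) = c"
    unfolding c_def by (rule irr_measure_eqI) (use * in \<open>auto simp: K_def L_def\<close>)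
  moreover obtain q where q: "0 < q" "q < L" "dist_int (real q * \<alpha>) \<le> 1 / real L"
    using dirichlet_strict_denominator[of L \<alpha>] by (auto simp: L_def)
  ultimately have "c \<le> 1 / real L" using irr_measure_le[of q L \<alpha>] by simp
  moreover have "real M \<le> real L" by (simp add: L_def)
  moreover have "real L > 0" by (simp add: L_def)
  ultimately have "c * real L \<le> 1" and "real M \<le> real L" by (simp_all add: field_simps)
  moreover have "1 < real M * c" using M c by (simp add: field_simps)
  moreover have "c * real M \<le> c * real L" using \<open>real M \<le> real L\<close> c by simp
  ultimately show False by (simp add: mult.commute)
qed

lemma exists_next_best:
  assumes "\<alpha> \<notin> \<rat>" 
  obtains q where "N < q" "best \<alpha> q" "\<And>m. N < m \<Longrightarrow> m < q \<Longrightarrow> \<not> best \<alpha> m"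
proof -
  define q where "q = (LEAST q. N < q \<and> best \<alpha> q)"
  have "N < q \<and> best \<alpha> q" unfolding q_def
    by (rule LeastI_ex) (use exists_best_gt[OF assms, of N] in auto)
  moreover have "\<not> best \<alpha> m" if "N < m" "m < q" for m
    using that not_less_Least[of m "\<lambda>q. N < q \<and> best \<alpha> q"] unfolding q_def by blast
  ultimately show ?thesis using that by blast
qed

text \<open>Up to \<open>q' - 1\<close> the measure function keeps the value that it attains at
  \<open>q\<close>.\<close>

lemma dist_int_ge_consecutive:
  assumes "consecutive \<alpha> q q'" "0 < m" "m < q'"
  shows "dist_int (real q * \<alpha>) \<le> dist_int (real m * \<alpha>)"
proof -
  have q: "best \<alpha> q" "1 \<le> q" "q \<le> q' - 1" using assms(1) by (auto simp: consecutive_def best_def)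
  have "irr_measure \<alpha> (real (q' - 1)) = irr_measure \<alpha> (real q)"
    by (rule irr_measure_eqI) (use assms q in \<open>auto simp: consecutive_def\<close>)
  then show ?thesis using irr_measure_best[OF q(1)] irr_measure_le[of m "q' - 1" \<alpha>] assms by auto
qed

lemma irr_measure_consecutive_less:
  assumes "consecutive \<alpha> q q'"
  shows "irr_measure \<alpha> (real q') < irr_measure \<alpha> (real q)"
  using assms irr_measure_best by (auto simp: consecutive_def best_def)

text \<open>The parallelogram spanned by two consecutive minimal points of the lattice has area 1:
  the errors have opposite signs, so the determinant is \<open>q' \<xi> + q \<xi>'\<close>, a positive integer below 2.\<close>

lemma consecutive_determinant:
  assumes irr: "\<alpha> \<notin> \<rat>" and con: "consecutive \<alpha> q q'"
  defines "p \<equiv> round (real q * \<alpha>)" and "p' \<equiv> round (real q' * \<alpha>)"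
  shows "(real q * \<alpha> - of_int p) * (real q' * \<alpha> - of_int p') < 0"
    and "\<bar>int q * p' - int q' * p\<bar> = 1"
    and "real q' * irr_measure \<alpha> (real q) + real q * irr_measure \<alpha> (real q') = 1"
proof -
  define e where "e = real q * \<alpha> - of_int p"
  define e' where "e' = real q' * \<alpha> - of_int p'"
  have q: "0 < q" "q < q'" "best \<alpha> q" "best \<alpha> q'" using con by (auto simp: consecutive_def best_def)
  have e: "\<bar>e\<bar> = irr_measure \<alpha> (real q)" "\<bar>e\<bar> = dist_int (real q * \<alpha>)"
    using irr_measure_best[OF q(3)] by (simp_all add: e_def p_def dist_int_eq_round)
  have e': "\<bar>e'\<bar> = irr_measure \<alpha> (real q')"
    using irr_measure_best[OF q(4)] by (simp add: e'_def p'_def dist_int_eq_round)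
  have lt: "\<bar>e'\<bar> < \<bar>e\<bar>" using irr_measure_consecutive_less[OF con] e e' by simp
  have pos: "0 < \<bar>e'\<bar>" unfolding e' by (rule irr_measure_pos[OF irr]) (use q in auto)
  have diff: "real (q' - q) * \<alpha> - of_int (p' - p) = e' - e"
    using q by (simp add: e_def e'_def of_nat_diff algebra_simps)
  \<comment> \<open>Errors of equal sign would make \<open>\<bar>e' - e\<bar>\<close> smaller than
    \<open>\<bar>e\<bar>\<close>, although \<open>q' - q\<close> is a positive multiplier below
    \<open>q'\<close>.\<close>
  have "\<bar>e\<bar> \<le> \<bar>e' - e\<bar>"
    using dist_int_ge_consecutive[OF con, of "q' - q"] dist_int_le[of "real (q' - q) * \<alpha>" "p' - p"] q
    unfolding e(2) diff by simp
  with lt pos have sgn: "(0 < e \<and> e' < 0) \<or> (e < 0 \<and> 0 < e')" by linarith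
  then show "(real q * \<alpha> - of_int p) * (real q' * \<alpha> - of_int p') < 0"
    unfolding e_def[symmetric] e'_def[symmetric] by (auto simp: mult_less_0_iff)
  define D where "D = int q * p' - int q' * p"
  have D: "of_int D = real q' * e - real q * e'"
    by (simp add: D_def e_def e'_def algebra_simps)
  have absD: "\<bar>of_int D\<bar> = real q' * \<bar>e\<bar> + real q * \<bar>e'\<bar>"
    using sgn
  proof
    assume "0 < e \<and> e' < 0"
    moreover from this have "real q' * e > 0" "real q * e' < 0" using q by (auto simp: mult_pos_neg)
    ultimately show ?thesis unfolding D by simp
  next
    assume "e < 0 \<and> 0 < e'"
    moreover from this have "real q' * e < 0" "real q * e' > 0" using q by (auto simp: mult_pos_neg)
    ultimately show ?thesis unfolding D by simp
  qed
  \<comment> \<open>The Dirichlet multiplier is strictly below \<open>q'\<close>, so its bound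
    passes to \<open>q\<close>: the first summand of \<open>absD\<close> is at most 1. The second is
    smaller than the first, whence the total is below 2.\<close>
  obtain m where m: "0 < m" "m < q'" "dist_int (real m * \<alpha>) \<le> 1 / real q'"
    using dirichlet_strict_denominator[of q' \<alpha>] q by auto
  have "\<bar>e\<bar> \<le> 1 / real q'" using dist_int_ge_consecutive[OF con m(1,2)] m(3) e by simp
  then have le1: "real q' * \<bar>e\<bar> \<le> 1" using q by (simp add: field_simps)
  have "real q * \<bar>e'\<bar> < real q' * \<bar>e\<bar>"
    using q lt by (intro mult_strict_mono) auto
  with le1 absD have "\<bar>of_int D :: real\<bar> < 2" by simp
  moreover have "\<bar>of_int D :: real\<bar> > 0" unfolding absD using q lt pos by (intro add_pos_pos mult_pos_pos) auto
  ultimately have "\<bar>D\<bar> < 2" "\<bar>D\<bar> > 0" by linarith+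
  then have D1: "\<bar>D\<bar> = 1" by linarith
  then show "\<bar>int q * p' - int q' * p\<bar> = 1" by (simp add: D_def)
  from D1 have "\<bar>of_int D :: real\<bar> = 1" by (metis of_int_1 of_int_abs)
  with absD e e' show "real q' * irr_measure \<alpha> (real q) + real q * irr_measure \<alpha> (real q') = 1"
    by simp
qed

lemma consecutive_product_less_1:
  assumes "\<alpha> \<notin> \<rat>" "consecutive \<alpha> q q'"
  shows "real q' * irr_measure \<alpha> (real q) < 1"
proof -
  have "0 < q" "0 < q'" using assms(2) by (auto simp: consecutive_def best_def)
  then have "0 < real q * irr_measure \<alpha> (real q')"
    using irr_measure_pos[OF assms(1), of q'] by simp
  then show ?thesis using consecutive_determinant(3)[OF assms] by linarith
qed

text \<open>The errors at \<open>q\<close> and \<open>q''\<close> have the same sign, so the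
  multiplier \<open>q'' - q\<close> has an error below that at \<open>q\<close> and must be at least
  \<open>q'\<close>. Inserting \<open>q'' \<ge> q' + q\<close> into the determinant identity gives
  the bound.\<close>

lemma three_consecutive:
  assumes irr: "\<alpha> \<notin> \<rat>" and con: "consecutive \<alpha> q q'" "consecutive \<alpha> q' q''"
  shows "1 \<le> real q'' * irr_measure \<alpha> (real q)"
proof -
  define e where "e = real q * \<alpha> - of_int (round (real q * \<alpha>))"
  define e' where "e' = real q' * \<alpha> - of_int (round (real q' * \<alpha>))"
  define e'' where "e'' = real q'' * \<alpha> - of_int (round (real q'' * \<alpha>))"
  have q: "0 < q" "q < q'" "q' < q''" "best \<alpha> q" "best \<alpha> q'" "best \<alpha> q''"
    using con by (auto simp: consecutive_def best_def)
  have s: "e * e' < 0" "e' * e'' < 0"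
    using consecutive_determinant(1)[OF irr con(1)] consecutive_determinant(1)[OF irr con(2)]
    by (simp_all add: e_def e'_def e''_def)
  have le: "\<bar>e''\<bar> < \<bar>e\<bar>"
    using irr_measure_consecutive_less[OF con(1)] irr_measure_consecutive_less[OF con(2)]
      irr_measure_best q by (simp add: e_def e''_def dist_int_eq_round)
  have e: "\<bar>e\<bar> = dist_int (real q * \<alpha>)" by (simp add: e_def dist_int_eq_round)
  have "real (q'' - q) * \<alpha> - of_int (round (real q'' * \<alpha>) - round (real q * \<alpha>)) = e'' - e"
    using q by (simp add: e_def e''_def of_nat_diff algebra_simps)
  then have "dist_int (real (q'' - q) * \<alpha>) \<le> \<bar>e'' - e\<bar>"
    using dist_int_le[of "real (q'' - q) * \<alpha>" "round (real q'' * \<alpha>) - round (real q * \<alpha>)"] by simp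
  also have "\<dots> < \<bar>e\<bar>" using s le by (auto simp: mult_less_0_iff)
  finally have "\<not> q'' - q < q'"
    using dist_int_ge_consecutive[OF con(1), of "q'' - q"] q e by fastforce
  then have "q' + q \<le> q''" using q by linarith
  then have "real q' + real q \<le> real q''" by linarith
  moreover have "0 < irr_measure \<alpha> (real q)" using irr_measure_pos[OF irr, of q] q by simp
  ultimately have "(real q' + real q) * irr_measure \<alpha> (real q) \<le> real q'' * irr_measure \<alpha> (real q)"
    by simp
  moreover have "real q * irr_measure \<alpha> (real q') \<le> real q * irr_measure \<alpha> (real q)"
    using irr_measure_consecutive_less[OF con(1)] by (simp add: mult_left_mono)
  ultimately show ?thesis
    using consecutive_determinant(3)[OF irr con(1)] by (simp add: distrib_right)
qed

section \<open>Two irrationality measure functions\<close>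

text \<open>With \<open>r\<close> the last jump of \<open>\<beta>\<close> up to \<open>q\<close> and
  \<open>s1\<close>, \<open>s2\<close> the next two, \<open>s2 \<le> q'\<close> would give \<open>1
  \<le> s2 * \<psi>_\<beta>(r) \<le> q' * \<psi>_\<alpha>(q) < 1\<close>.\<close>

lemma best_below_at_most_once:
  assumes irr: "\<alpha> \<notin> \<rat>" "\<beta> \<notin> \<rat>" and con: "consecutive \<alpha> q q'"
    and below: "irr_measure \<beta> (real q) < irr_measure \<alpha> (real q)"
    and s: "best \<beta> s" "q < s" and s': "best \<beta> s'" "s < s'"
  shows "q' < s'"
proof (rule ccontr)
  assume "\<not> q' < s'"
  have q: "1 \<le> q" "q < q'" using con by (auto simp: consecutive_def best_def)
  obtain r where r: "best \<beta> r" "r \<le> q" "\<And>m. r < m \<Longrightarrow> m \<le> q \<Longrightarrow> \<not> best \<beta> m"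
    "irr_measure \<beta> (real q) = irr_measure \<beta> (real r)"
    using exists_last_best[OF q(1), of \<beta>] by blast
  obtain s1 where s1: "q < s1" "best \<beta> s1" "\<And>m. q < m \<Longrightarrow> m < s1 \<Longrightarrow> \<not> best \<beta> m"
    using exists_next_best[OF irr(2), of q] by blast
  obtain s2 where s2: "s1 < s2" "best \<beta> s2" "\<And>m. s1 < m \<Longrightarrow> m < s2 \<Longrightarrow> \<not> best \<beta> m"
    using exists_next_best[OF irr(2), of s1] by blast
  have "s1 \<le> s" using s1 s by (meson not_less)
  then have "s2 \<le> s'" using s2 s' by (meson le_less_trans not_less)
  have "consecutive \<beta> r s1" by (rule consecutiveI[of _ r s1 q]) (use r s1 in auto)
  moreover have "consecutive \<beta> s1 s2" using s1 s2 by (auto simp: consecutive_def)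
  ultimately have "1 \<le> real s2 * irr_measure \<beta> (real r)" by (rule three_consecutive[OF irr(2)])
  also have "\<dots> \<le> real q' * irr_measure \<alpha> (real q)"
    using \<open>s2 \<le> s'\<close> \<open>\<not> q' < s'\<close> r below irr_measure_pos[OF irr(2) q(1)] by (intro mult_mono) auto
  also have "\<dots> < 1"
    by (rule consecutive_product_less_1[OF irr(1) con])
  finally show False by simp
qed

text \<open>The only jump \<open>s\<close> of \<open>\<beta>\<close> in the range and its
  predecessor \<open>r\<close> satisfy \<open>s \<le> q'\<close> and \<open>r \<le> q\<close>. Were
  \<open>\<beta>\<close> still not above \<open>\<alpha>\<close> at \<open>q'\<close>, the
  determinant identity for \<open>r, s\<close> would have a strictly smaller left side than that for
  \<open>q, q'\<close>, yet both equal 1.\<close>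

lemma best_below_overtaken:
  assumes irr: "\<alpha> \<notin> \<rat>" "\<beta> \<notin> \<rat>" and con: "consecutive \<alpha> q q'"
    and below: "irr_measure \<beta> (real q) < irr_measure \<alpha> (real q)"
    and s: "best \<beta> s" "q < s" "s \<le> q'"
  shows "irr_measure \<alpha> (real q') < irr_measure \<beta> (real q')"
proof (rule ccontr)
  assume neg: "\<not> irr_measure \<alpha> (real q') < irr_measure \<beta> (real q')"
  have q: "1 \<le> q" "q < q'" using con by (auto simp: consecutive_def best_def)
  obtain r where r: "best \<beta> r" "r \<le> q" "\<And>m. r < m \<Longrightarrow> m \<le> q \<Longrightarrow> \<not> best \<beta> m"
    "irr_measure \<beta> (real q) = irr_measure \<beta> (real r)"
    using exists_last_best[OF q(1), of \<beta>] by blast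
  have once: "m = s" if "best \<beta> m" "q < m" "m \<le> q'" for m
    using best_below_at_most_once[OF irr con below, of m s]
      best_below_at_most_once[OF irr con below, of s m] that s
    by (cases m s rule: linorder_cases) auto
  have con': "consecutive \<beta> r s"
  proof (rule consecutiveI[of _ r s q])
    show "\<not> best \<beta> m" if "q < m" "m < s" for m
      using that once[of m] s by auto
  qed (use r s in auto)
  have s_eq: "irr_measure \<beta> (real q') = irr_measure \<beta> (real s)"
  proof (rule irr_measure_eqI)
    show "\<not> best \<beta> m" if "s < m" "m \<le> q'" for m
      using that once[of m] s by auto
  qed (use s q in auto)
  have "real s * irr_measure \<beta> (real r) < real s * irr_measure \<alpha> (real q)"
    using s below r by simp
  also have "\<dots> \<le> real q' * irr_measure \<alpha> (real q)"
    using s irr_measure_pos[OF irr(1) q(1)] by simp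
  finally have "real s * irr_measure \<beta> (real r) < real q' * irr_measure \<alpha> (real q)" .
  moreover have "real r * irr_measure \<beta> (real s) \<le> real q * irr_measure \<alpha> (real q')"
    using r s_eq neg irr_measure_pos[OF irr(2), of s] s by (intro mult_mono) auto
  ultimately show False
    using consecutive_determinant(3)[OF irr(1) con] consecutive_determinant(3)[OF irr(2) con'] by linarith
qed


lemma consecutive_around:
  assumes "\<alpha> \<notin> \<rat>" "best \<alpha> T" "T < s"
  obtains y x where "consecutive \<alpha> y x" "T \<le> y" "y < s" "s \<le> x"
proof -
  have s: "1 \<le> s - 1" using assms(2,3) unfolding best_def by linarith
  \<comment> \<open>Splitting at \<open>s - 1\<close> makes \<open>s\<close> itself the right end
    \<open>x\<close> when \<open>\<alpha>\<close> jumps there.\<close>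
  obtain y where y: "best \<alpha> y" "y \<le> s - 1" "\<And>m. y < m \<Longrightarrow> m \<le> s - 1 \<Longrightarrow> \<not> best \<alpha> m"
    "irr_measure \<alpha> (real (s - 1)) = irr_measure \<alpha> (real y)"
    using exists_last_best[OF s, of \<alpha>] by blast
  obtain x where x: "s - 1 < x" "best \<alpha> x" "\<And>m. s - 1 < m \<Longrightarrow> m < x \<Longrightarrow> \<not> best \<alpha> m"
    using exists_next_best[OF assms(1), of "s - 1"] by blast
  have "consecutive \<alpha> y x" by (rule consecutiveI[of _ y x "s - 1"]) (use x y in auto)
  moreover have "T \<le> y" using y(3)[of T] assms(2,3) by force
  moreover have "y < s" "s \<le> x" using x y assms(3) by auto
  ultimately show ?thesis using that by blast
qed

lemma consecutive_le:
  assumes "consecutive \<alpha> y x" "best \<alpha> m" "y < m"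
  shows "x \<le> m"
  using assms by (cases "x \<le> m") (auto simp: consecutive_def)

text \<open>Both functions are nonincreasing, so the order can be reversed only by a drop of the one
  that ends up lower.\<close>

lemma best_of_overtaking:
  assumes "1 \<le> N" "irr_measure \<beta> (real N) \<le> irr_measure \<alpha> (real N)"
    and "irr_measure \<alpha> (real (Suc N)) < irr_measure \<beta> (real (Suc N))"
  shows "best \<alpha> (Suc N)"
proof (rule ccontr)
  assume *: "\<not> best \<alpha> (Suc N)"
  have "irr_measure \<alpha> (real (Suc N)) = irr_measure \<alpha> (real N)"
  proof (rule irr_measure_eqI)
    show "\<not> best \<alpha> m" if "N < m" "m \<le> Suc N" for m
      using that * by (auto simp: le_Suc_eq)
  qed (use assms in auto)
  moreover have "irr_measure \<beta> (real (Suc N)) \<le> irr_measure \<beta> (real N)"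
    using assms(1) by (intro irr_measure_antimono) auto
  ultimately show False using assms by linarith
qed

section \<open>Incommensurability and shared pairs of consecutive denominators\<close>

lemma dist_int_add_of_int: "dist_int (x + of_int m) = dist_int x"
proof -
  have le: "dist_int (y + of_int l) \<le> dist_int y" for y l
    using dist_int_le[of "y + of_int l" "round y + l"] by (simp add: dist_int_eq_round)
  show ?thesis using le[of x m] le[of "x + of_int m" "- m"] by simp
qed

lemma dist_int_minus: "dist_int (- x) = dist_int x"
proof -
  have le: "dist_int (- y) \<le> dist_int y" for y
    using dist_int_le[of "- y" "- round y"] by (simp add: dist_int_eq_round)
  show ?thesis using le[of x] le[of "- x"] by simp
qed

lemma irr_measure_eq_if_diff_Ints:
  assumes "\<alpha> - \<beta> \<in> \<int>"
  shows "irr_measure \<alpha> t = irr_measure \<beta> t"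
proof -
  obtain m where "\<alpha> = \<beta> + of_int m" using assms by (metis Ints_cases add.commute diff_add_cancel)
  then have "real q * \<alpha> = real q * \<beta> + of_int (int q * m)" for q
    by (simp add: algebra_simps)
  then have "dist_int (real q * \<alpha>) = dist_int (real q * \<beta>)" for q
    by (simp only: dist_int_add_of_int)
  then show ?thesis by (simp add: irr_measure_def)
qed

lemma irr_measure_minus: "irr_measure (- \<beta>) t = irr_measure \<beta> t"
  by (simp add: irr_measure_def dist_int_minus)

text \<open>If \<open>\<alpha>\<close> were congruent to \<open>\<beta>\<close> or to
  \<open>-\<beta>\<close> modulo 1, the measure functions would coincide. The two distances serve as
  the threshold that a shared pair of late denominators would violate.\<close>

lemma incommensurable_dist_int_pos:
  assumes "incommensurable \<alpha> \<beta>"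
  shows "0 < dist_int (\<alpha> - \<beta>)" "0 < dist_int (\<alpha> + \<beta>)"
proof -
  have ex: "\<exists>t. irr_measure \<alpha> t \<noteq> irr_measure \<beta> t"
    using assms eventually_happens'[OF trivial_limit_at_top_linorder]
    unfolding incommensurable_def by blast
  have pos: "0 < dist_int x" if "x \<notin> \<int>" for x
    using that dist_int_nonneg[of x] dist_int_eq_0_iff[of x] by linarith
  have "\<alpha> - \<beta> \<notin> \<int>" using ex irr_measure_eq_if_diff_Ints[of \<alpha> \<beta>] by blast
  then show "0 < dist_int (\<alpha> - \<beta>)" by (rule pos)
  have "\<alpha> - (- \<beta>) \<notin> \<int>"
    using ex irr_measure_eq_if_diff_Ints[of \<alpha> "- \<beta>"] unfolding irr_measure_minus by blast
  then show "0 < dist_int (\<alpha> + \<beta>)" using pos by simp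
qed

text \<open>The pair \<open>q, q'\<close> determines the numerator of the convergent with denominator \<open>q\<close> modulo \<open>q\<close>, up to sign.\<close>

lemma dist_int_le_if_shared_consecutive:
  assumes irr: "\<alpha> \<notin> \<rat>" "\<beta> \<notin> \<rat>" and con: "consecutive \<alpha> q q'" "consecutive \<beta> q q'"
  shows "dist_int (\<alpha> - \<beta>) \<le> 1 / real q \<or> dist_int (\<alpha> + \<beta>) \<le> 1 / real q"
proof -
  have q: "0 < q" using con by (auto simp: consecutive_def best_def)
  define p p' where "p = round (real q * \<alpha>)" and "p' = round (real q' * \<alpha>)"
  define r r' where "r = round (real q * \<beta>)" and "r' = round (real q' * \<beta>)"
  define \<epsilon> where "\<epsilon> = int q * p' - int q' * p"
  define \<delta> where "\<delta> = int q * r' - int q' * r"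
  \<comment> \<open>\<open>s\<close> is the relative sign of the two determinants; it decides
    between \<open>\<alpha> - \<beta>\<close> and \<open>\<alpha> + \<beta>\<close>.\<close>
  define s where "s = \<epsilon> * \<delta>"
  have "\<bar>\<epsilon>\<bar> = 1" "\<bar>\<delta>\<bar> = 1"
    using consecutive_determinant(2)[OF irr(1) con(1)] consecutive_determinant(2)[OF irr(2) con(2)]
    by (simp_all add: \<epsilon>_def \<delta>_def p_def p'_def r_def r'_def)
  then have signs: "\<epsilon> = 1 \<or> \<epsilon> = - 1" "\<delta> = 1 \<or> \<delta> = - 1" by linarith+
  then have s: "s = 1 \<or> s = - 1" and s\<delta>: "s * \<delta> = \<epsilon>" by (auto simp: s_def)
  have "int q' * (p - s * r) = (int q * p' - \<epsilon>) - s * (int q * r' - \<delta>)"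
    by (simp add: \<epsilon>_def \<delta>_def algebra_simps)
  also have "\<dots> = int q * (p' - s * r')"
    using s\<delta> by (simp add: algebra_simps)
  finally have "int q dvd int q' * (p - s * r)" by simp
  moreover have "coprime (int q) (int q')"
  proof (rule coprimeI)
    fix c assume "c dvd int q" "c dvd int q'"
    then have "c dvd \<epsilon>" unfolding \<epsilon>_def by simp
    with signs show "is_unit c" by auto
  qed
  ultimately have "int q dvd p - s * r" by (simp add: coprime_dvd_mult_right_iff)
  then obtain m where m: "p - s * r = int q * m" by (elim dvdE)
  \<comment> \<open>As \<open>p\<close> and \<open>s * r\<close> agree modulo \<open>q\<close>, only
    the two approximation errors remain, each at most one half.\<close>
  have "real q * (\<alpha> - of_int s * \<beta> - of_int m)
      = (real q * \<alpha> - of_int p) - of_int s * (real q * \<beta> - of_int r) + of_int (p - s * r - int q * m)"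
    by (simp add: algebra_simps)
  also have "\<bar>\<dots>\<bar> \<le> \<bar>real q * \<alpha> - of_int p\<bar> + \<bar>real q * \<beta> - of_int r\<bar>"
    using s m by auto
  also have "\<dots> \<le> 1"
    using dist_int_le_half[of "real q * \<alpha>"] dist_int_le_half[of "real q * \<beta>"]
    by (simp add: dist_int_eq_round p_def r_def)
  finally have "\<bar>\<alpha> - of_int s * \<beta> - of_int m\<bar> \<le> 1 / real q"
    using q by (simp add: abs_mult pos_le_divide_eq mult.commute)
  then have "dist_int (\<alpha> - of_int s * \<beta>) \<le> 1 / real q"
    using dist_int_le[of "\<alpha> - of_int s * \<beta>" m] by linarith
  with s show ?thesis by auto
qed

lemma eventually_not_shared_consecutive:
  assumes "\<alpha> \<notin> \<rat>" "\<beta> \<notin> \<rat>" "incommensurable \<alpha> \<beta>"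
  shows "\<forall>\<^sub>F q in sequentially. \<forall>q'. consecutive \<alpha> q q' \<longrightarrow> \<not> consecutive \<beta> q q'"
proof -
  define c where "c = min (dist_int (\<alpha> - \<beta>)) (dist_int (\<alpha> + \<beta>))"
  have "c > 0" using incommensurable_dist_int_pos[OF assms(3)] by (simp add: c_def)
  then have "\<forall>\<^sub>F q in sequentially. 1 / real q < c"
    using lim_1_over_n[where 'a = real] by (rule order_tendstoD(2)[rotated])
  then show ?thesis
  proof eventually_elim
    case (elim q)
    then show ?case
      using dist_int_le_if_shared_consecutive[OF assms(1,2), of q] by (force simp: c_def)
  qed
qed

lemma irr_measure_Rats_eventually_0:
  assumes "\<alpha> \<in> \<rat>"
  shows "\<forall>\<^sub>F t in at_top. irr_measure \<alpha> t = 0"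
proof -
  obtain m :: int and d :: nat where d: "d \<noteq> 0" "\<alpha> = of_int m / real d"
    using assms unfolding Rats_eq_int_div_nat by blast
  then have 0: "dist_int (real d * \<alpha>) = 0" by (simp add: dist_int_eq_0_iff)
  show ?thesis
    using eventually_ge_at_top[of "real d"]
  proof eventually_elim
    case (elim t)
    have "finite {q::nat. 0 < q \<and> real q \<le> t}"
    proof (rule finite_subset)
      show "{q::nat. 0 < q \<and> real q \<le> t} \<subseteq> {..nat \<lfloor>t\<rfloor>}"
        by (auto simp: le_nat_floor)
    qed simp
    moreover have "d \<in> {q::nat. 0 < q \<and> real q \<le> t}" using d elim by simp
    ultimately show ?case
      unfolding irr_measure_def using 0 dist_int_nonneg by (intro Min_eqI) (auto intro!: image_eqI[where x = d])
  qed
qed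

text \<open>Both measure functions eventually vanish. This is why a tuple contains at most one
  rational member.\<close>

lemma not_incommensurable_Rats:
  assumes "\<alpha> \<in> \<rat>" "\<beta> \<in> \<rat>"
  shows "\<not> incommensurable \<alpha> \<beta>"
proof
  assume "incommensurable \<alpha> \<beta>"
  then have "\<forall>\<^sub>F t in at_top. irr_measure \<alpha> t \<noteq> irr_measure \<beta> t" by (simp add: incommensurable_def)
  then have "\<forall>\<^sub>F t :: real in at_top. False"
    using irr_measure_Rats_eventually_0[OF assms(1)] irr_measure_Rats_eventually_0[OF assms(2)]
    by eventually_elim simp
  then show False by simp
qed

section \<open>Counting the recurrent orderings\<close>

definition recurrent :: "nat \<Rightarrow> (nat \<Rightarrow> real) \<Rightarrow> (nat \<Rightarrow> nat) \<Rightarrow> bool" where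
  "recurrent n \<alpha> \<sigma> \<longleftrightarrow> (\<forall>t0>0. \<exists>t>t0. order_perm n \<alpha> t = \<sigma>)"

lemma card_recurrent_le_k_index:
  assumes "finite S" "\<And>\<sigma>. \<sigma> \<in> S \<Longrightarrow> \<sigma> permutes {1..n} \<and> recurrent n \<alpha> \<sigma>"
  shows "card S \<le> k_index n \<alpha>"
proof -
  obtain h where h: "bij_betw h {1..card S} S"
    using ex_bij_betw_nat_finite_1[OF assms(1)] by blast
  then have "card S \<in> k_index_set n \<alpha>"
    unfolding k_index_set_def using assms(2)
    by (auto simp: bij_betw_def recurrent_def intro!: exI[of _ h])
  then show ?thesis unfolding k_index_def by (rule Max_ge[OF finite_k_index_set])
qed

text \<open>There are finitely many permutations, and each one that is not recurrent is absent from
  some time on. So every ordering observed late enough counts towards the index.\<close>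

lemma eventually_recurrent:
  assumes "pairwise_incommensurable n \<alpha>"
  shows "\<forall>\<^sub>F t in at_top. recurrent n \<alpha> (order_perm n \<alpha> t)"
proof -
  have "\<forall>\<^sub>F t in at_top. order_perm n \<alpha> t = \<sigma> \<longrightarrow> recurrent n \<alpha> \<sigma>" for \<sigma>
  proof (cases "recurrent n \<alpha> \<sigma>")
    case False
    then obtain t0 where "\<And>t. t > t0 \<Longrightarrow> order_perm n \<alpha> t \<noteq> \<sigma>" by (auto simp: recurrent_def)
    then show ?thesis by (intro eventually_mono[OF eventually_gt_at_top[of t0]]) auto
  qed simp
  then have "\<forall>\<^sub>F t in at_top. \<forall>\<sigma>\<in>{\<sigma>. \<sigma> permutes {1..n}}. order_perm n \<alpha> t = \<sigma> \<longrightarrow> recurrent n \<alpha> \<sigma>"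
    by (intro eventually_ball_finite) (auto intro: finite_permutations)
  then show ?thesis using eventually_is_order_perm[OF assms]
    by eventually_elim (auto simp: is_order_perm_def)
qed

lemma is_order_permD:
  assumes "is_order_perm n \<alpha> t \<sigma>" "a \<in> {1..n}" "b \<in> {1..n}" "a < b"
  shows "irr_measure (\<alpha> (\<sigma> b)) t < irr_measure (\<alpha> (\<sigma> a)) t"
  using assms unfolding is_order_perm_def by blast

text \<open>Collects what holds from some time on, to replace repeated reasoning about eventuality.
  Natural times suffice, because exhibiting recurrent orderings there already bounds the index from
  below.\<close>

locale stable_range =
  fixes n :: nat and \<alpha> :: "nat \<Rightarrow> real" and N0 :: nat
  assumes N0_pos: "1 \<le> N0"
    and order: "N0 \<le> N \<Longrightarrow> is_order_perm n \<alpha> (real N) (order_perm n \<alpha> (real N))"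
    and rec: "N0 \<le> N \<Longrightarrow> recurrent n \<alpha> (order_perm n \<alpha> (real N))"
    and unshared: "\<lbrakk>i \<in> {1..n}; j \<in> {1..n}; i \<noteq> j; \<alpha> i \<notin> \<rat>; \<alpha> j \<notin> \<rat>; N0 \<le> q; consecutive (\<alpha> i) q q'\<rbrakk>
      \<Longrightarrow> \<not> consecutive (\<alpha> j) q q'"

lemma exists_stable_range:
  assumes "pairwise_incommensurable n \<alpha>"
  shows "\<exists>N0. stable_range n \<alpha> N0"
proof -
  have "\<forall>\<^sub>F N in sequentially. is_order_perm n \<alpha> (real N) (order_perm n \<alpha> (real N)) \<and>
      recurrent n \<alpha> (order_perm n \<alpha> (real N))"
    by (rule eventually_compose_filterlim[OF _ filterlim_real_sequentially])
       (intro eventually_conj eventually_is_order_perm eventually_recurrent assms)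
  moreover have "\<forall>\<^sub>F q in sequentially. \<forall>i\<in>{1..n}. \<forall>j\<in>{1..n}. i \<noteq> j \<and> \<alpha> i \<notin> \<rat> \<and> \<alpha> j \<notin> \<rat> \<longrightarrow>
      (\<forall>q'. consecutive (\<alpha> i) q q' \<longrightarrow> \<not> consecutive (\<alpha> j) q q')"
  proof (intro eventually_ball_finite ballI)
    fix i j assume ij: "i \<in> {1..n}" "j \<in> {1..n}"
    show "\<forall>\<^sub>F q in sequentially. i \<noteq> j \<and> \<alpha> i \<notin> \<rat> \<and> \<alpha> j \<notin> \<rat> \<longrightarrow>
      (\<forall>q'. consecutive (\<alpha> i) q q' \<longrightarrow> \<not> consecutive (\<alpha> j) q q')"
    proof (cases "i \<noteq> j \<and> \<alpha> i \<notin> \<rat> \<and> \<alpha> j \<notin> \<rat>")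
      case True
      then have "incommensurable (\<alpha> i) (\<alpha> j)"
        using assms ij by (auto simp: pairwise_incommensurable_def)
      with True eventually_not_shared_consecutive[of "\<alpha> i" "\<alpha> j"] show ?thesis by simp
    qed auto
  qed auto
  ultimately have "\<forall>\<^sub>F N in sequentially. (is_order_perm n \<alpha> (real N) (order_perm n \<alpha> (real N)) \<and>
      recurrent n \<alpha> (order_perm n \<alpha> (real N))) \<and>
      (\<forall>i\<in>{1..n}. \<forall>j\<in>{1..n}. i \<noteq> j \<and> \<alpha> i \<notin> \<rat> \<and> \<alpha> j \<notin> \<rat> \<longrightarrow>
      (\<forall>q'. consecutive (\<alpha> i) N q' \<longrightarrow> \<not> consecutive (\<alpha> j) N q'))"
    by (rule eventually_conj)
  then obtain K where K: "\<And>N. K \<le> N \<Longrightarrow> (is_order_perm n \<alpha> (real N) (order_perm n \<alpha> (real N)) \<and>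
      recurrent n \<alpha> (order_perm n \<alpha> (real N))) \<and>
      (\<forall>i\<in>{1..n}. \<forall>j\<in>{1..n}. i \<noteq> j \<and> \<alpha> i \<notin> \<rat> \<and> \<alpha> j \<notin> \<rat> \<longrightarrow>
      (\<forall>q'. consecutive (\<alpha> i) N q' \<longrightarrow> \<not> consecutive (\<alpha> j) N q'))"
    unfolding eventually_sequentially by blast
  have "stable_range n \<alpha> (max K 1)"
  proof
    fix i j q q'
    assume "i \<in> {1..n}" "j \<in> {1..n}" "i \<noteq> j" "\<alpha> i \<notin> \<rat>" "\<alpha> j \<notin> \<rat>" "max K 1 \<le> q"
      "consecutive (\<alpha> i) q q'"
    then show "\<not> consecutive (\<alpha> j) q q'" using K[of q] by (auto simp del: atLeastAtMost_iff)
  qed (use K in auto)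
  then show ?thesis by blast
qed

lemma card_le_mult_card_image:
  assumes "finite A" "\<And>y. y \<in> f ` A \<Longrightarrow> card {x \<in> A. f x = y} \<le> c"
  shows "card A \<le> c * card (f ` A)"
proof -
  have "card A = card (\<Union>y\<in>f ` A. {x \<in> A. f x = y})" by (rule arg_cong[where f = card]) auto
  also have "\<dots> \<le> (\<Sum>y\<in>f ` A. card {x \<in> A. f x = y})"
    using assms(1) by (intro card_UN_le) auto
  also have "\<dots> \<le> of_nat (card (f ` A)) * c" by (rule sum_bounded_above) (use assms(2) in auto)
  finally show ?thesis by (simp add: mult.commute)
qed

section \<open>Times of first overtaking and the counts derived from them\<close>

context stable_range
begin

abbreviation \<psi> :: "nat \<Rightarrow> nat \<Rightarrow> real" where
  "\<psi> i N \<equiv> irr_measure (\<alpha> i) (real N)"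

definition irr_index :: "nat set" where
  "irr_index = {i \<in> {1..n}. \<alpha> i \<notin> \<rat>}"

definition overtake :: "nat \<Rightarrow> nat \<Rightarrow> nat \<Rightarrow> nat" where
  "overtake i j T = (LEAST M. T \<le> M \<and> \<psi> i M < \<psi> j M)"

definition next_best :: "nat \<Rightarrow> nat \<Rightarrow> nat" where
  "next_best i T = (LEAST q. T < q \<and> best (\<alpha> i) q)"

lemma irr_indexD: "i \<in> irr_index \<Longrightarrow> i \<in> {1..n} \<and> \<alpha> i \<notin> \<rat>"
  by (simp add: irr_index_def)

lemma finite_irr_index: "finite irr_index"
  by (simp add: irr_index_def)

lemma less_transfer:
  assumes "N0 \<le> M" "N0 \<le> N" "order_perm n \<alpha> (real M) = order_perm n \<alpha> (real N)"
    and ij: "i \<in> {1..n}" "j \<in> {1..n}" and less: "\<psi> j M < \<psi> i M"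
  shows "\<psi> j N < \<psi> i N"
proof -
  define \<sigma> where "\<sigma> = order_perm n \<alpha> (real N)"
  have M: "is_order_perm n \<alpha> (real M) \<sigma>" and N: "is_order_perm n \<alpha> (real N) \<sigma>"
    using order[OF assms(1)] order[OF assms(2)] assms(3) by (simp_all add: \<sigma>_def)
  then have "\<sigma> ` {1..n} = {1..n}" by (simp add: is_order_perm_def permutes_image)
  then obtain a b where ab: "a \<in> {1..n}" "b \<in> {1..n}" "i = \<sigma> a" "j = \<sigma> b"
    using ij by (metis imageE)
  have "\<not> b < a" using is_order_permD[OF M ab(2,1)] ab less by force
  moreover have "a \<noteq> b" using ab less by auto
  ultimately show ?thesis using is_order_permD[OF N ab(1,2)] ab by simp
qed

lemma distinct_values:
  assumes "N0 \<le> N" "i \<in> {1..n}" "j \<in> {1..n}" "i \<noteq> j"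
  shows "\<psi> i N \<noteq> \<psi> j N"
proof -
  define \<sigma> where "\<sigma> = order_perm n \<alpha> (real N)"
  have N: "is_order_perm n \<alpha> (real N) \<sigma>" using order[OF assms(1)] by (simp add: \<sigma>_def)
  then have "\<sigma> ` {1..n} = {1..n}" by (simp add: is_order_perm_def permutes_image)
  then obtain a b where ab: "a \<in> {1..n}" "b \<in> {1..n}" "i = \<sigma> a" "j = \<sigma> b"
    using assms by (metis imageE)
  then show ?thesis
    using is_order_permD[OF N, of a b] is_order_permD[OF N, of b a] assms(4)
    by (cases a b rule: linorder_cases) auto
qed

lemma next_best:
  assumes "i \<in> irr_index"
  shows "T < next_best i T" "best (\<alpha> i) (next_best i T)"
    and "\<And>m. T < m \<Longrightarrow> best (\<alpha> i) m \<Longrightarrow> next_best i T \<le> m"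
proof -
  have "T < next_best i T \<and> best (\<alpha> i) (next_best i T)"
    unfolding next_best_def
    by (rule LeastI_ex) (use exists_best_gt irr_indexD[OF assms] in auto)
  then show "T < next_best i T" "best (\<alpha> i) (next_best i T)" by auto
  show "\<And>m. T < m \<Longrightarrow> best (\<alpha> i) m \<Longrightarrow> next_best i T \<le> m"
    unfolding next_best_def by (rule Least_le) simp
qed

lemma consecutive_next_best:
  assumes "i \<in> irr_index" "best (\<alpha> i) T"
  shows "consecutive (\<alpha> i) T (next_best i T)"
  unfolding consecutive_def
proof (intro conjI allI impI)
  show "\<not> best (\<alpha> i) m" if "T < m \<and> m < next_best i T" for m
    using next_best(3)[OF assms(1), of T m] that by auto
qed (use assms next_best in auto)

text \<open>Overtaking means getting below. It does happen: a late jump \<open>s\<close> of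
  \<open>j\<close> lies in some period \<open>(y, x]\<close> of \<open>i\<close>. Either
  \<open>i\<close> is below \<open>j\<close> at \<open>y\<close> already, or the jump of
  \<open>j\<close> forces \<open>i\<close> to be below at \<open>x\<close>. By minimality the
  reversal is caused by a drop of \<open>i\<close>.\<close>

lemma overtake:
  assumes i: "i \<in> irr_index" and j: "j \<in> irr_index" and T: "N0 \<le> T" and less: "\<psi> j T < \<psi> i T"
  shows "T < overtake i j T" "\<psi> i (overtake i j T) < \<psi> j (overtake i j T)"
    and "\<And>N. T \<le> N \<Longrightarrow> N < overtake i j T \<Longrightarrow> \<psi> j N < \<psi> i N"
    and "best (\<alpha> i) (overtake i j T)"
proof -
  let ?f = "overtake i j T"
  have ij: "i \<noteq> j" using less by auto
  have irr: "\<alpha> i \<notin> \<rat>" "\<alpha> j \<notin> \<rat>" using i j by (auto simp: irr_index_def)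
  have neq: "\<psi> i N \<noteq> \<psi> j N" if "T \<le> N" for N
    using distinct_values[of N i j] irr_indexD i j ij T that by auto
  have "\<exists>M. T \<le> M \<and> \<psi> i M < \<psi> j M"
  proof -
    obtain q where q: "T < q" "best (\<alpha> i) q" using exists_best_gt[OF irr(1)] by blast
    obtain s where s: "q < s" "best (\<alpha> j) s" using exists_best_gt[OF irr(2)] by blast
    obtain y x where yx: "consecutive (\<alpha> i) y x" "q \<le> y" "y < s" "s \<le> x"
      using consecutive_around[OF irr(1) q(2) s(1)] by blast
    show ?thesis
    proof (cases "\<psi> j y < \<psi> i y")
      case True
      have "\<psi> i x < \<psi> j x" by (rule best_below_overtaken[OF irr yx(1) True s(2) yx(3,4)])
      then show ?thesis using yx q by (intro exI[of _ x]) auto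
    next
      case False
      then show ?thesis using neq[of y] yx q by (intro exI[of _ y]) auto
    qed
  qed
  then have f: "T \<le> ?f \<and> \<psi> i ?f < \<psi> j ?f" unfolding overtake_def by (rule LeastI_ex)
  then show "\<psi> i ?f < \<psi> j ?f" by simp
  show Tf: "T < ?f" using f less by (metis le_neq_implies_less less_asym)
  show before: "\<psi> j N < \<psi> i N" if "T \<le> N" "N < ?f" for N
    using not_less_Least[of N "\<lambda>M. T \<le> M \<and> \<psi> i M < \<psi> j M"] that neq[of N]
    unfolding overtake_def by fastforce
  obtain N where N: "?f = Suc N" "T \<le> N" using Tf by (metis less_imp_Suc_add le_add1)
  show "best (\<alpha> i) ?f"
    unfolding N(1) by (rule best_of_overtaking[of _ "\<alpha> j"]) (use f N before[of N] N0_pos T in auto)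
qed

lemma overtake_le:
  assumes "T \<le> M" "\<psi> i M < \<psi> j M"
  shows "overtake i j T \<le> M"
  unfolding overtake_def using assms by (intro Least_le) auto

text \<open>Each first overtaking creates an inversion that did not exist before,
  so the orderings at distinct overtaking times are distinct.\<close>

lemma card_overtake_times:
  assumes "A \<subseteq> irr_index" "N0 \<le> T"
    and p: "\<And>i. i \<in> A \<Longrightarrow> p i \<in> irr_index \<and> \<psi> (p i) T < \<psi> i T"
  shows "card ((\<lambda>i. overtake i (p i) T) ` A) + 1 \<le> k_index n \<alpha>"
proof -
  define F where "F = (\<lambda>i. overtake i (p i) T) ` A"
  define g where "g N = order_perm n \<alpha> (real N)" for N
  have fin: "finite F" unfolding F_def using assms(1) finite_irr_index finite_subset by blast
  have gt: "T < w" if "w \<in> F" for w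
    using that overtake(1) assms by (auto simp: F_def)
  have neq: "g M \<noteq> g w" if w: "w \<in> F" and M: "T \<le> M" "M < w" for M w
  proof
    assume eq: "g M = g w"
    obtain i where i: "i \<in> A" "w = overtake i (p i) T" using w by (auto simp: F_def)
    have ii: "i \<in> irr_index" "p i \<in> irr_index" "\<psi> (p i) T < \<psi> i T" using i p assms(1) by auto
    have "\<psi> (p i) M < \<psi> i M" using overtake(3)[OF ii(1,2) assms(2) ii(3)] M i by simp
    then have "\<psi> (p i) w < \<psi> i w"
      using less_transfer[of M w i "p i"] eq ii irr_indexD M assms(2) by (auto simp: g_def)
    with overtake(2)[OF ii(1,2) assms(2) ii(3)] i show False by simp
  qed
  have "inj_on g (insert T F)"
  proof (rule inj_onI)
    fix M N assume "M \<in> insert T F" "N \<in> insert T F" "g M = g N"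
    then show "M = N"
      using neq[of M N] neq[of N M] gt[of M] gt[of N]
      by (cases M N rule: linorder_cases) (auto dest: less_imp_le)
  qed
  \<comment> \<open>All overtaking times are later than \<open>T\<close>, so the ordering at
    \<open>T\<close> contributes one more.\<close>
  then have "card (g ` insert T F) = card F + 1"
    using fin gt by (auto simp: card_image card_insert_if)
  moreover have "card (g ` insert T F) \<le> k_index n \<alpha>"
  proof (rule card_recurrent_le_k_index)
    fix \<sigma> assume "\<sigma> \<in> g ` insert T F"
    then obtain N where N: "\<sigma> = g N" "N = T \<or> N \<in> F" by blast
    then have "N0 \<le> N" using gt[of N] assms(2) by auto
    then show "\<sigma> permutes {1..n} \<and> recurrent n \<alpha> \<sigma>"
      using order rec N by (auto simp: g_def is_order_perm_def)
  qed (use fin in simp)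
  ultimately show ?thesis by (simp add: F_def)
qed

lemma k_index_pos: "1 \<le> k_index n \<alpha>"
  using card_overtake_times[of "{}" N0] by simp

text \<open>If \<open>i\<close> and \<open>j\<close> (with \<open>j\<close> below \<open>i\<close> at \<open>T\<close>) overtake their partners at the same time \<open>w\<close>, then
  \<open>j\<close> jumps nowhere between \<open>T\<close> and \<open>w\<close>. As next jumps from a common \<open>T\<close> are distinct, this
  bounds the number of simultaneous overtakings by 2.\<close>

lemma next_best_eq_overtake:
  assumes T: "N0 \<le> T" and ip: "i \<in> irr_index" "p \<in> irr_index" and jr: "j \<in> irr_index" "r \<in> irr_index"
    and best: "best (\<alpha> i) T" "best (\<alpha> j) T"
    and below: "\<psi> p T < \<psi> i T" "\<psi> r T < \<psi> j T"
    and min_i: "next_best p T \<le> next_best j T"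
    and min_j: "\<psi> p T < \<psi> j T \<Longrightarrow> next_best r T \<le> next_best p T"
    and w: "overtake i p T = w" "overtake j r T = w"
  shows "next_best j T = w"
proof -
  note irr = irr_indexD[OF ip(1), THEN conjunct2] irr_indexD[OF ip(2), THEN conjunct2]
    irr_indexD[OF jr(1), THEN conjunct2] irr_indexD[OF jr(2), THEN conjunct2]
  note oi = overtake[OF ip T below(1), unfolded w] and oj = overtake[OF jr T below(2), unfolded w]
  have vj_le: "next_best j T \<le> w" by (rule next_best(3)[OF jr(1) oj(1,4)])
  show ?thesis
  proof (cases "next_best r T \<le> next_best j T")
    \<comment> \<open>The partner \<open>r\<close> drops within the first period of
      \<open>j\<close>, so \<open>j\<close> is below it at the end of that period.\<close>
    case True
    have "\<psi> j (next_best j T) < \<psi> r (next_best j T)"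
      by (rule best_below_overtaken[OF irr(3,4) consecutive_next_best[OF jr(1) best(2)] below(2)
            next_best(2)[OF jr(2)] next_best(1)[OF jr(2)] True])
    then have "w \<le> next_best j T"
      using overtake_le[of T "next_best j T" j r] next_best(1)[OF jr(1), of T] w by simp
    with vj_le show ?thesis by simp
  next
    case False
    \<comment> \<open>Otherwise \<open>min_j\<close> and \<open>min_i\<close> would place the jump
      of \<open>r\<close> no later than that of \<open>j\<close>.\<close>
    then have p_above_j: "\<psi> j T \<le> \<psi> p T" using min_i min_j by force
    obtain y x where yx: "consecutive (\<alpha> i) y x" "T \<le> y" "y < w" "w \<le> x"
      using consecutive_around[OF irr(1) best(1) oi(1)] by blast
    then have con: "consecutive (\<alpha> i) y w"
      using consecutive_le[OF yx(1) oi(4) yx(3)] by simp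
    \<comment> \<open>A jump of \<open>p\<close> up to \<open>y\<close> would lie in a period of
      \<open>i\<close> ending by \<open>y\<close>, and \<open>i\<close> would overtake
      \<open>p\<close> there, before \<open>w\<close>.\<close>
    have y_lt: "y < next_best p T"
    proof (rule ccontr)
      assume "\<not> y < next_best p T"
      obtain y0 x0 where yx0: "consecutive (\<alpha> i) y0 x0" "T \<le> y0" "y0 < next_best p T" "next_best p T \<le> x0"
        using consecutive_around[OF irr(1) best(1) next_best(1)[OF ip(2)]] by blast
      have "x0 \<le> y"
        using consecutive_le[OF yx0(1), of y] yx(1) yx0(3) \<open>\<not> y < next_best p T\<close>
        by (simp add: consecutive_def)
      have "\<psi> p y0 < \<psi> i y0"
        using oi(3)[of y0] yx yx0 \<open>\<not> y < next_best p T\<close> by simp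
      then have "\<psi> i x0 < \<psi> p x0"
        by (rule best_below_overtaken[OF irr(1,2) yx0(1) _ next_best(2)[OF ip(2)] yx0(3,4)])
      with oi(3)[of x0] \<open>x0 \<le> y\<close> yx yx0 show False by simp
    qed
    have const: "\<psi> l y = \<psi> l T" if "l \<in> irr_index" "y < next_best l T" for l
    proof (rule irr_measure_eqI)
      show "\<not> best (\<alpha> l) m" if "T < m" "m \<le> y" for m
        using next_best(3)[OF \<open>l \<in> irr_index\<close> \<open>T < m\<close>] that \<open>y < next_best l T\<close> by auto
    qed (use yx T N0_pos in auto)
    \<comment> \<open>Neither \<open>p\<close> nor \<open>j\<close> has jumped by time
      \<open>y\<close>, so \<open>j\<close> is still not above \<open>p\<close>, which is below
      \<open>i\<close>.\<close>
    have "\<psi> j y < \<psi> i y"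
      using const[OF ip(2)] const[OF jr(1)] y_lt min_i p_above_j oi(3)[of y] yx by simp
    \<comment> \<open>In \<open>(y, w]\<close> the function of \<open>j\<close> jumps at most once,
      and it does jump at \<open>w\<close>.\<close>
    have "\<not> next_best j T < w"
      using best_below_at_most_once[OF irr(1,3) con \<open>\<psi> j y < \<psi> i y\<close> next_best(2)[OF jr(1)] _ oj(4)]
        y_lt min_i by fastforce
    with vj_le show ?thesis by simp
  qed
qed

text \<open>Each index of \<open>G\<close> but the lowest is paired with the one below it in
  \<open>G\<close> that jumps next. Every overtaking time then serves at most two indices, and there
  are at most \<open>k - 1\<close> such times.\<close>

lemma card_common_best:
  assumes T: "N0 \<le> T" and G: "G \<subseteq> irr_index" "\<And>i. i \<in> G \<Longrightarrow> best (\<alpha> i) T"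
  shows "card G + 1 \<le> 2 * k_index n \<alpha>"
proof (cases "G = {}")
  case True
  then show ?thesis using k_index_pos by simp
next
  case False
  have fin: "finite G" using G(1) finite_irr_index finite_subset by blast
  have inj\<psi>: "\<psi> i T \<noteq> \<psi> j T" if "i \<in> G" "j \<in> G" "i \<noteq> j" for i j
    using distinct_values[OF T, of i j] that G irr_indexD by blast
  \<comment> \<open>All members jump at \<open>T\<close>, so equal next jumps would be a shared pair
    of consecutive denominators.\<close>
  have inj_next: "next_best i T \<noteq> next_best j T" if "i \<in> G" "j \<in> G" "i \<noteq> j" for i j
    using unshared[of i j T "next_best i T"] consecutive_next_best[of i T] consecutive_next_best[of j T]
      that G irr_indexD T by (metis subsetD)
  define b where "b = arg_min_on (\<lambda>i. \<psi> i T) G"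
  have b: "b \<in> G" "\<And>i. i \<in> G \<Longrightarrow> \<not> \<psi> i T < \<psi> b T"
    using arg_min_if_finite[OF fin False, of "\<lambda>i. \<psi> i T"] by (auto simp: b_def)
  define L where "L i = {j \<in> G. \<psi> j T < \<psi> i T}" for i
  define p where "p i = arg_min_on (\<lambda>j. next_best j T) (L i)" for i
  \<comment> \<open>The lowest member \<open>b\<close> has nothing in \<open>G\<close> below it and
    stays unpaired.\<close>
  define A where "A = G - {b}"
  have L: "finite (L i)" "L i \<noteq> {}" if "i \<in> A" for i
  proof -
    show "finite (L i)" using fin by (simp add: L_def)
    have "b \<in> L i" using b(1) b(2)[of i] inj\<psi>[of b i] that by (auto simp: L_def A_def)
    then show "L i \<noteq> {}" by blast
  qed
  have p: "p i \<in> G" "\<psi> (p i) T < \<psi> i T" "\<And>j. j \<in> L i \<Longrightarrow> next_best (p i) T \<le> next_best j T"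
    if "i \<in> A" for i
    using arg_min_if_finite[OF L[OF that], of "\<lambda>j. next_best j T"]
    by (auto simp: p_def L_def not_less)
  define f where "f i = overtake i (p i) T" for i
  have key: "next_best j T = w" if "i \<in> A" "j \<in> A" "\<psi> j T < \<psi> i T" "f i = w" "f j = w" for i j w
  proof (rule next_best_eq_overtake[OF T, of i "p i" j "p j"])
    show "next_best (p i) T \<le> next_best j T" using p(3)[of i j] that by (auto simp: L_def A_def)
    show "next_best (p j) T \<le> next_best (p i) T" if "\<psi> (p i) T < \<psi> j T"
      using p(3)[of j "p i"] p(1)[of i] that \<open>i \<in> A\<close> \<open>j \<in> A\<close> by (auto simp: L_def)
  qed (use that p(1,2) G in \<open>auto simp: A_def f_def\<close>)
  have "card {i \<in> A. f i = w} \<le> 2" for w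
  proof (cases "{i \<in> A. f i = w} = {}")
    case nonempty: False
    let ?F = "{i \<in> A. f i = w}"
    have finF: "finite ?F" using fin by (simp add: A_def)
    \<comment> \<open>\<open>m\<close> is the highest member of the fibre at \<open>T\<close>. Every
      other member has next jump \<open>w\<close> by \<open>key\<close>, and next jumps are
      distinct, so only one other member is possible.\<close>
    define m where "m = arg_min_on (\<lambda>i. - \<psi> i T) ?F"
    have m: "m \<in> ?F" "\<And>j. j \<in> ?F \<Longrightarrow> \<not> - \<psi> j T < - \<psi> m T"
      using arg_min_if_finite[OF finF nonempty, of "\<lambda>i. - \<psi> i T"] unfolding m_def by blast+
    have next_w: "next_best j T = w" if j: "j \<in> ?F - {m}" for j
    proof (rule key[of m])
      have "\<psi> j T \<noteq> \<psi> m T" by (rule inj\<psi>) (use j m(1) in \<open>auto simp: A_def\<close>)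
      then show "\<psi> j T < \<psi> m T" using m(2)[of j] j by force
    qed (use j m(1) in auto)
    have "i = j" if ij: "i \<in> ?F - {m}" "j \<in> ?F - {m}" for i j
    proof (rule ccontr)
      assume "i \<noteq> j"
      then have "next_best i T \<noteq> next_best j T"
        by (intro inj_next) (use ij in \<open>auto simp: A_def\<close>)
      then show False using next_w ij by metis
    qed
    then have "card (?F - {m}) \<le> Suc 0"
      using finF by (subst card_le_Suc0_iff_eq) blast+
    then show ?thesis using card_Suc_Diff1[OF finF m(1)] by linarith
  qed (simp only: card.empty le0)
  then have "card A \<le> 2 * card (f ` A)"
    using fin by (intro card_le_mult_card_image) (auto simp: A_def)
  moreover have "card (f ` A) + 1 \<le> k_index n \<alpha>"
    unfolding f_def by (rule card_overtake_times[OF _ T]) (use G p in \<open>auto simp: A_def\<close>)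
  moreover have "card G = card A + 1"
    using card_Suc_Diff1[OF fin b(1)] by (simp add: A_def)
  ultimately show ?thesis by linarith
qed

text \<open>Here all indices are paired with the lowest one at \<open>N0\<close>. Those that
  overtake it at a common time \<open>w\<close> all jump at \<open>w\<close>, so
  \<open>card_common_best\<close> with \<open>w\<close> as starting time bounds each fibre.\<close>

lemma card_irr_index:
  "card irr_index \<le> 1 + (2 * k_index n \<alpha> - 1) * (k_index n \<alpha> - 1)"
proof (cases "irr_index = {}")
  case False
  define b where "b = arg_min_on (\<lambda>i. \<psi> i N0) irr_index"
  have b: "b \<in> irr_index" "\<And>i. i \<in> irr_index \<Longrightarrow> \<not> \<psi> i N0 < \<psi> b N0"
    using arg_min_if_finite[OF finite_irr_index False, of "\<lambda>i. \<psi> i N0"] by (auto simp: b_def)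
  define A where "A = irr_index - {b}"
  have less: "\<psi> b N0 < \<psi> i N0" if "i \<in> A" for i
    using b(2)[of i] distinct_values[of N0 i b] irr_indexD[of i] irr_indexD[OF b(1)] that
    by (force simp: A_def)
  define f where "f i = overtake i b N0" for i
  have "card {i \<in> A. f i = w} \<le> 2 * k_index n \<alpha> - 1" if "w \<in> f ` A" for w
  proof -
    have best: "best (\<alpha> i) w \<and> N0 < w" if "i \<in> A" "f i = w" for i
      using overtake(1,4)[of i b N0] b(1) less that by (auto simp: f_def A_def)
    have "card {i \<in> A. f i = w} + 1 \<le> 2 * k_index n \<alpha>"
    proof (rule card_common_best[of w])
      show "N0 \<le> w" using best that by force
    qed (use best in \<open>auto simp: A_def\<close>)
    then show ?thesis by simp
  qed
  then have "card A \<le> (2 * k_index n \<alpha> - 1) * card (f ` A)"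
    using finite_irr_index by (intro card_le_mult_card_image) (auto simp: A_def)
  also have "card (f ` A) + 1 \<le> k_index n \<alpha>"
    unfolding f_def by (rule card_overtake_times) (use b less in \<open>auto simp: A_def\<close>)
  then have "(2 * k_index n \<alpha> - 1) * card (f ` A) \<le> (2 * k_index n \<alpha> - 1) * (k_index n \<alpha> - 1)"
    by (intro mult_le_mono2) simp
  finally show ?thesis
    using b(1) finite_irr_index card_Suc_Diff1[of irr_index b] by (simp add: A_def)
qed simp

end

theorem mainTheorem1:
  fixes n :: nat and \<alpha> :: "nat \<Rightarrow> real"
  assumes "n \<ge> 1"
    and "pairwise_incommensurable n \<alpha>"
  shows "real (k_index n \<alpha>) \<ge> sqrt (real n / 2)"
proof -
  obtain N0 where "stable_range n \<alpha> N0" using exists_stable_range[OF assms(2)] by blast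
  then interpret stable_range n \<alpha> N0 .
  let ?k = "k_index n \<alpha>"
  have "card ({1..n} - irr_index) \<le> 1"
  proof -
    have "i = j" if "i \<in> {1..n} - irr_index" "j \<in> {1..n} - irr_index" for i j
    proof -
      have "\<not> incommensurable (\<alpha> i) (\<alpha> j)"
        by (rule not_incommensurable_Rats) (use that in \<open>auto simp: irr_index_def\<close>)
      then show ?thesis using assms(2) that unfolding pairwise_incommensurable_def by blast
    qed
    then show ?thesis by (simp add: card_le_Suc0_iff_eq)
  qed
  moreover have "card ({1..n} - irr_index) = n - card irr_index"
    using finite_irr_index by (subst card_Diff_subset) (auto simp: irr_index_def)
  \<comment> \<open>One unit of the 2 is the possible rational member, the other the lowest
    irrational one. The right side equals \<open>2 k^2 - 3 (k - 1)\<close>, so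
    \<open>k \<ge> 1\<close> gives the next bound.\<close>
  ultimately have "n \<le> 2 + (2 * ?k - 1) * (?k - 1)" using card_irr_index by linarith
  also have "\<dots> \<le> 2 * ?k\<^sup>2"
  proof -
    obtain m where m: "?k = Suc m" using k_index_pos by (cases ?k) auto
    show ?thesis unfolding m by (simp add: power2_eq_square algebra_simps)
  qed
  finally have "real n \<le> real (2 * ?k\<^sup>2)" by (simp only: of_nat_le_iff)
  then have "real n / 2 \<le> (real ?k)\<^sup>2" by simp
  then show ?thesis by (intro real_le_lsqrt) auto
qed

end
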